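(* Suppose $F:V\to\mathbb R$ is convex and $L_F$-smooth, and $N:V\to V$ is $\mu$-strongly monotone with $\mu>0$, i.e. $(N(x)-N(y),x-y)\ge\mu\|x-y\|^2$ for all $x,y\in V$. Let $x^\star$ satisfy $\nabla F(x^\star)+N(x^\star)=0$. Let $(x_k,y_k)$ be the sequence generated, with the initial value $(x_0,y_0)$, by the AOR-VOS scheme $$\frac{x_{k+1}-x_k}{\alpha}=2y_{k+1}-y_k-x_{k+1},\qquad \frac{y_{k+1}-y_k}{\alpha}=-\frac1\mu\big(\nabla F(x_k)+N(y_{k+1})\big),$$ with step size $\alpha=\sqrt{\mu/L_F}$. Define $$\mathcal E(x,y)=D_F(x,x^\star)+\frac\mu2\|y-x^\star\|^2,\qquad \mathcal E^\alpha(x,y)=\mathcal E(x,y)-\alpha\langle\nabla F(x)-\nabla F(x^\star),y-x^\star\rangle .$$ Then $\mathcal E^\alpha(x,y)$ serves as a Lyapunov function, and the method achieves the accelerated linear convergence $$\mathcal E^\alpha(x_{k+1},y_{k+1})\le\left(\frac{1}{1+\sqrt{\mu/L_F}}\right)^{k+1}\mathcal E^\alpha(x_0,y_0),\qquad k\ge0,$$ and $$\mathcal E(x_{k+1},y_{k+1})\le\sqrt{\frac{L_F}{\mu}}\left(\frac{1}{1+\sqrt{\mu/L_F}}\right)^{k}\mathcal E^\alpha(x_0,y_0),\qquad k\ge0.$$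
   Context: $V$ is a real Hilbert space with inner product $(\cdot,\cdot)$ and norm $\|\cdot\|$, identified with its dual; $\langle\cdot,\cdot\rangle$ is the duality pairing. $F$ is $L_F$-smooth if it is continuously differentiable and its gradient is Lipschitz continuous with constant $0<L_F<\infty$. The Bregman divergence is $D_F(y,x)=F(y)-F(x)-\langle\nabla F(x),y-x\rangle$. The scheme is a discretization of the variable and operator splitting (VOS) flow $x'=y-x$, $y'=-\frac1\mu(\nabla F(x)+N(y))$, whose equilibrium point is $(x^\star,x^\star)$. A Lyapunov function $E(z)$ associated to an ODE $z'=\mathcal G(z)$ with equilibrium point $z^\star$ is described as a function that usually satisfies: (non-negativity) $E(z)\ge0$ for all $z$; (optimality) $E(z)=0$ if and only if $z=z^\star$; (Lyapunov condition) $-\langle\nabla E(z),\mathcal G(z)\rangle\ge0$ for all $z$ near $z^\star$.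
   Formalization: "Lyapunov function" is stated for the scheme, not the flow: E^α≥0, E^α=0 at (x*,x* ), and no increase over any step. Uniqueness of the zero fails (F=0: E^α=μ/2‖y-x*‖² vanishes at all (x,x* )), and the flow condition fails for F=x²/2, N(y)=y, μ=L_F=1. *)

theory Defs
  imports "HOL-Analysis.Analysis"
begin

text \<open>The Hilbert space is identified with its dual, so the gradient is an element of the space
  and the duality pairing is the inner product. The value is meaningful only where a gradient
  exists, which \<open>L_smooth\<close> below requires at every point.\<close>

definition gradient :: "('a::real_inner \<Rightarrow> real) \<Rightarrow> 'a \<Rightarrow> 'a" where
  "gradient F x = (THE D. GDERIV F x :> D)"

definition L_smooth :: "real \<Rightarrow> ('a::real_inner \<Rightarrow> real) \<Rightarrow> bool" where
  "L_smooth L F \<longleftrightarrow>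
     (\<forall>x. \<exists>D. GDERIV F x :> D) \<and> continuous_on UNIV (gradient F) \<and>
     0 < L \<and> L-lipschitz_on UNIV (gradient F)"

definition bregman :: "('a::real_inner \<Rightarrow> real) \<Rightarrow> 'a \<Rightarrow> 'a \<Rightarrow> real" where
  "bregman F y x = F y - F x - gradient F x \<bullet> (y - x)"

definition strongly_monotone :: "real \<Rightarrow> ('a::real_inner \<Rightarrow> 'a) \<Rightarrow> bool" where
  "strongly_monotone \<mu> N \<longleftrightarrow> (\<forall>x y. (N x - N y) \<bullet> (x - y) \<ge> \<mu> * (norm (x - y))\<^sup>2)"

text \<open>The scheme is a relation between consecutive iterates, since it is implicit in \<open>N\<close>.\<close>

definition aor_vos_step ::
  "real \<Rightarrow> real \<Rightarrow> ('a::real_inner \<Rightarrow> real) \<Rightarrow> ('a \<Rightarrow> 'a) \<Rightarrow> 'a \<times> 'a \<Rightarrow> 'a \<times> 'a \<Rightarrow> bool" where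
  "aor_vos_step \<alpha> \<mu> F N = (\<lambda>(x, y) (x', y').
     (x' - x) /\<^sub>R \<alpha> = 2 *\<^sub>R y' - y - x' \<and>
     (y' - y) /\<^sub>R \<alpha> = - ((1 / \<mu>) *\<^sub>R (gradient F x + N y')))"

definition energy :: "real \<Rightarrow> ('a::real_inner \<Rightarrow> real) \<Rightarrow> 'a \<Rightarrow> 'a \<times> 'a \<Rightarrow> real" where
  "energy \<mu> F xs = (\<lambda>(x, y). bregman F x xs + \<mu> / 2 * (norm (y - xs))\<^sup>2)"

definition shifted_energy ::
  "real \<Rightarrow> real \<Rightarrow> ('a::real_inner \<Rightarrow> real) \<Rightarrow> 'a \<Rightarrow> 'a \<times> 'a \<Rightarrow> real" where
  "shifted_energy \<alpha> \<mu> F xs = (\<lambda>(x, y).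
     energy \<mu> F xs (x, y) - \<alpha> * ((gradient F x - gradient F xs) \<bullet> (y - xs)))"

text \<open>Lyapunov function of a discrete scheme with equilibrium \<open>zs\<close>: the last conjunct is the
  discrete form of \<open>- \<langle>\<nabla>E(z), G(z)\<rangle> \<ge> 0\<close>. Zeros of \<open>E\<close> other than \<open>zs\<close> are allowed: for
  \<open>F(x) = L/2 * (norm x)^2\<close> and \<open>\<alpha> = sqrt (\<mu>/L)\<close>, the shifted energy at \<open>xs = 0\<close> is
  \<open>1/2 * (norm (sqrt L x - sqrt \<mu> y))^2\<close>, which vanishes on a whole subspace.\<close>

definition lyapunov_function :: "('z \<Rightarrow> 'z \<Rightarrow> bool) \<Rightarrow> 'z \<Rightarrow> ('z \<Rightarrow> real) \<Rightarrow> bool" where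
  "lyapunov_function step zs E \<longleftrightarrow>
     step zs zs \<and> (\<forall>z. E z \<ge> 0) \<and> E zs = 0 \<and> (\<forall>z z'. step z z' \<longrightarrow> E z' \<le> E z)"

end

theory Submission
  imports Defs
begin

text \<open>
  The shifted energy decreases along the scheme by an amount that controls the energies at the new
  point. Write \<open>D\<close> for the Bregman divergence, \<open>g, g', g*\<close> for the gradients at \<open>x, x', xs\<close>, and
  \<open>u' = x' - xs\<close>, \<open>v = y - xs\<close>, \<open>v' = y' - xs\<close>. Expanding the two quadratic-like parts of the energy
  around the new iterate, inserting the scheme and estimating \<open>N\<close> by strong monotonicity, all mixed
  terms collect into the single product \<open>\<alpha> * (g' - g) \<bullet> (v' - v)\<close>:
  the over-relaxed \<open>2y' - y\<close> and the shift \<open>- \<alpha> * (g - g*) \<bullet> v\<close> are chosen for exactly this. Hence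
  the change of the shifted energy is at most
  \<open>\<alpha> * (g' - g) \<bullet> (v' - v) - D(x, x') - \<mu>/2 * |v' - v|^2 - \<alpha> * ((g' - g*) \<bullet> u' + \<mu> * |v'|^2)\<close>.

  A convex function with \<open>L\<close>-Lipschitz gradient satisfies \<open>D(x, x') \<ge> |g' - g|^2 / (2L)\<close>
  (\<open>gradient_gap_le_bregman\<close>). Since \<open>\<alpha>^2 * L = \<mu>\<close>, Young's inequality (\<open>weighted_young\<close>) absorbs
  the mixed term completely, so only the last, negative term survives
  (\<open>shifted_energy_decrease\<close>). It equals \<open>- \<alpha> * (D(x', xs) + D(xs, x') + \<mu> * |v'|^2)\<close>, whose bracket
  dominates both the energy and, by the same Young inequality, the shifted energy at the new point.
  The second comparison gives contraction by \<open>1 / (1 + \<alpha>)\<close>; the first, together with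
  non-negativity of the shifted energy, gives \<open>\<alpha> * energy z' \<le> shifted_energy z\<close>, which is the
  rate for the unshifted energy.
\<close>

section \<open>Convex functions with Lipschitz gradient\<close>

lemma has_derivative_gradient:
  assumes "L_smooth L F"
  shows "(F has_derivative (\<lambda>h. h \<bullet> gradient F x)) (at x)"
proof -
  obtain D where D: "GDERIV F x :> D"
    using assms by (auto simp: L_smooth_def)
  have "D' = D" if "GDERIV F x :> D'" for D'
  proof -
    have "(\<lambda>h. h \<bullet> D') = (\<lambda>h. h \<bullet> D)"
      using that D has_derivative_unique unfolding gderiv_def by blast
    then show ?thesis
      by (metis vector_eq_ldot)
  qed
  then have "gradient F x = D"
    unfolding gradient_def using D by blast
  with D show ?thesis by (simp add: gderiv_def)
qed

lemma has_real_derivative_along_line: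
  assumes "L_smooth L F"
  shows "((\<lambda>t. F (x + t *\<^sub>R d)) has_real_derivative gradient F (x + t *\<^sub>R d) \<bullet> d) (at t within S)"
proof -
  have line: "((\<lambda>t. x + t *\<^sub>R d) has_derivative (\<lambda>t. t *\<^sub>R d)) (at t within S)"
    by (auto intro!: derivative_eq_intros)
  show ?thesis
    using has_derivative_compose[OF line has_derivative_gradient[OF assms]]
    by (simp add: has_field_derivative_def inner_commute mult_commute_abs)
qed

text \<open>The tangent inequality for convex functions, obtained from the one-dimensional case on the line
  through the two points.\<close>

lemma bregman_nonneg:
  assumes "convex_on UNIV F" "L_smooth L F"
  shows "0 \<le> bregman F y x"
proof -
  have "convex_on UNIV (\<lambda>t. F (x + t *\<^sub>R (y - x)))"
  proof (rule convex_onI)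
    fix t s r :: real
    assume t: "0 < t" "t < 1"
    have "x + ((1 - t) *\<^sub>R s + t *\<^sub>R r) *\<^sub>R (y - x)
        = (1 - t) *\<^sub>R (x + s *\<^sub>R (y - x)) + t *\<^sub>R (x + r *\<^sub>R (y - x))"
      by (simp add: algebra_simps)
    then show "F (x + ((1 - t) *\<^sub>R s + t *\<^sub>R r) *\<^sub>R (y - x))
        \<le> (1 - t) * F (x + s *\<^sub>R (y - x)) + t * F (x + r *\<^sub>R (y - x))"
      using convex_onD[OF assms(1), of t] t by simp
  qed simp
  from convex_on_imp_above_tangent[OF this _ _ _ has_real_derivative_along_line[OF assms(2)],
      of 0 1]
  show ?thesis by (simp add: bregman_def)
qed

text \<open>The descent lemma: along the segment from \<open>x\<close> to \<open>y\<close> the slope of \<open>F\<close> exceeds its initial value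
  by at most \<open>L * t * |y - x|^2\<close>, which integrates to the quadratic bound.\<close>

lemma bregman_le_quadratic:
  assumes "L_smooth L F"
  shows "bregman F y x \<le> L / 2 * (norm (y - x))\<^sup>2"
proof -
  define d where "d = y - x"
  define \<phi> where "\<phi> t = F (x + t *\<^sub>R d) - t * (gradient F x \<bullet> d) - L / 2 * t\<^sup>2 * (norm d)\<^sup>2"
    for t :: real
  have "\<phi> 1 \<le> \<phi> 0"
  proof (rule DERIV_nonpos_imp_nonincreasing[where f = \<phi>])
    fix t :: real
    assume t: "0 \<le> t" "t \<le> 1"
    have deriv: "(\<phi> has_real_derivative
        gradient F (x + t *\<^sub>R d) \<bullet> d - gradient F x \<bullet> d - L * t * (norm d)\<^sup>2) (at t)"
      unfolding \<phi>_def
      by (auto intro!: derivative_eq_intros has_real_derivative_along_line[OF assms])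
    have "(gradient F (x + t *\<^sub>R d) - gradient F x) \<bullet> d
        \<le> norm (gradient F (x + t *\<^sub>R d) - gradient F x) * norm d"
      by (rule norm_cauchy_schwarz)
    also have "\<dots> \<le> (L * norm (x + t *\<^sub>R d - x)) * norm d"
      using assms by (intro mult_right_mono lipschitz_on_normD) (auto simp: L_smooth_def)
    also have "\<dots> = L * t * (norm d)\<^sup>2"
      using t by (simp add: power2_eq_square)
    finally show "\<exists>D. (\<phi> has_real_derivative D) (at t) \<and> D \<le> 0"
      using deriv by (auto simp: inner_diff_left)
  qed simp
  then show ?thesis
    by (simp add: \<phi>_def d_def bregman_def)
qed

text \<open>The function \<open>z \<mapsto> bregman F z x\<close> is non-negative, and one gradient step of length \<open>1 / L\<close> from
  \<open>y\<close> lowers it by at least \<open>|gradient F y - gradient F x|^2 / (2L)\<close>; so it was at least that large at \<open>y\<close>.\<close>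

lemma gradient_gap_le_bregman:
  assumes "convex_on UNIV F" "L_smooth L F"
  shows "(norm (gradient F y - gradient F x))\<^sup>2 / (2 * L) \<le> bregman F y x"
proof -
  have L: "L > 0" using assms(2) by (simp add: L_smooth_def)
  define p where "p = gradient F y - gradient F x"
  define w where "w = y - (1 / L) *\<^sub>R p"
  have "bregman F w x + (norm p)\<^sup>2 / L = bregman F y x + bregman F w y"
  proof -
    have "p \<bullet> (y - w) = (norm p)\<^sup>2 / L"
      by (simp add: w_def power2_norm_eq_inner)
    then show ?thesis
      by (simp add: p_def bregman_def inner_diff_left inner_diff_right)
  qed
  moreover have "bregman F w y \<le> (norm p)\<^sup>2 / (2 * L)"
    using bregman_le_quadratic[OF assms(2), of w y] L
    by (simp add: w_def power_divide power2_eq_square)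
  moreover have "0 \<le> bregman F w x"
    using assms by (rule bregman_nonneg)
  moreover have "(norm p)\<^sup>2 / L = (norm p)\<^sup>2 / (2 * L) + (norm p)\<^sup>2 / (2 * L)"
    by simp
  ultimately show ?thesis
    unfolding p_def by linarith
qed

lemma bregman_symmetrized:
  "bregman F x z + bregman F z x = (gradient F x - gradient F z) \<bullet> (x - z)"
  by (simp add: bregman_def inner_diff_left inner_diff_right)

section \<open>Decrease of the shifted energy\<close>

text \<open>Complete the square of \<open>p - \<alpha> * L * q\<close>. The step size \<open>\<alpha> = sqrt (\<mu> / L)\<close> balances the two weights
  \<open>1 / (2L)\<close> and \<open>\<mu> / 2\<close>: the first is what the Bregman divergence supplies, the second what the
  quadratic part of the energy supplies.\<close>

lemma weighted_young:
  fixes p q :: "'a::real_inner"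
  assumes "L > 0" "\<alpha>\<^sup>2 * L = \<mu>"
  shows "\<alpha> * (p \<bullet> q) \<le> (norm p)\<^sup>2 / (2 * L) + \<mu> / 2 * (norm q)\<^sup>2"
proof -
  have "(norm (p - (\<alpha> * L) *\<^sub>R q))\<^sup>2
      = (norm p)\<^sup>2 + (\<alpha> * L)\<^sup>2 * (norm q)\<^sup>2 - 2 * (\<alpha> * L) * (p \<bullet> q)"
    unfolding power2_norm_eq_inner
    by (simp add: inner_diff_left inner_diff_right inner_commute algebra_simps power2_eq_square)
  then have "(norm (p - (\<alpha> * L) *\<^sub>R q))\<^sup>2 / (2 * L)
      = (norm p)\<^sup>2 / (2 * L) + \<mu> / 2 * (norm q)\<^sup>2 - \<alpha> * (p \<bullet> q)"
    using assms by (simp add: field_simps power2_eq_square)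
  moreover have "0 \<le> (norm (p - (\<alpha> * L) *\<^sub>R q))\<^sup>2 / (2 * L)"
    using assms(1) by simp
  ultimately show ?thesis by linarith
qed

lemma shifted_energy_nonneg:
  assumes "convex_on UNIV F" "L_smooth L F" "\<alpha>\<^sup>2 * L = \<mu>"
  shows "0 \<le> shifted_energy \<alpha> \<mu> F xs z"
proof (cases z)
  case (Pair x y)
  have "L > 0" using assms(2) by (simp add: L_smooth_def)
  then show ?thesis
    using weighted_young[of L \<alpha> \<mu> "gradient F x - gradient F xs" "y - xs"]
      gradient_gap_le_bregman[OF assms(1,2), of x xs] assms(3)
    by (simp add: Pair shifted_energy_def energy_def)
qed

text \<open>The inner product is the symmetrized Bregman divergence, so both halves of this quantity contain
  the corresponding part of the energy and have something to spare. A step that arrives at the given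
  point lowers the shifted energy by at least \<open>\<alpha>\<close> times it.\<close>

definition dissipation ::
  "real \<Rightarrow> ('a::real_inner \<Rightarrow> real) \<Rightarrow> 'a \<Rightarrow> 'a \<times> 'a \<Rightarrow> real" where
  "dissipation \<mu> F xs = (\<lambda>(x, y).
     (gradient F x - gradient F xs) \<bullet> (x - xs) + \<mu> * (norm (y - xs))\<^sup>2)"

lemma energy_le_dissipation:
  assumes "convex_on UNIV F" "L_smooth L F" "\<mu> \<ge> 0"
  shows "energy \<mu> F xs z \<le> dissipation \<mu> F xs z"
proof (cases z)
  case (Pair x y)
  have "\<mu> / 2 * (norm (y - xs))\<^sup>2 \<le> \<mu> * (norm (y - xs))\<^sup>2"
    using assms(3) by (intro mult_right_mono) auto
  then show ?thesis
    using bregman_nonneg[OF assms(1,2), of xs x] bregman_symmetrized[of F x xs]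
    by (simp add: Pair energy_def dissipation_def)
qed

lemma shifted_energy_le_dissipation:
  assumes "convex_on UNIV F" "L_smooth L F" "\<alpha>\<^sup>2 * L = \<mu>"
  shows "shifted_energy \<alpha> \<mu> F xs z \<le> dissipation \<mu> F xs z"
proof (cases z)
  case (Pair x y)
  have "L > 0" using assms(2) by (simp add: L_smooth_def)
  then show ?thesis
    (* Young's inequality with the sign of one factor flipped, and the half of the symmetrized
       divergence that the energy leaves free. *)
    using weighted_young[of L \<alpha> \<mu> "gradient F xs - gradient F x" "y - xs"]
      gradient_gap_le_bregman[OF assms(1,2), of xs x] bregman_symmetrized[of F x xs] assms(3)
    by (simp add: Pair shifted_energy_def energy_def dissipation_def inner_diff_left algebra_simps)
qed

text \<open>Strong monotonicity enters through the equation for \<open>y'\<close>, with \<open>N xs = - gradient F xs\<close>;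
  the remainder \<open>\<alpha> * (g' - g) \<bullet> (y' - y)\<close> is absorbed by the second-order terms that the expansions
  around the new iterate leave behind.\<close>

lemma shifted_energy_decrease:
  assumes conv: "convex_on UNIV F" and smooth: "L_smooth L F"
    and mono: "strongly_monotone \<mu> N" and equil: "gradient F xs + N xs = 0"
    and "\<mu> > 0" "\<alpha> > 0" and step_size: "\<alpha>\<^sup>2 * L = \<mu>"
    and step: "aor_vos_step \<alpha> \<mu> F N z z'"
  shows "shifted_energy \<alpha> \<mu> F xs z' + \<alpha> * dissipation \<mu> F xs z' \<le> shifted_energy \<alpha> \<mu> F xs z"
proof -
  obtain x y x' y' where z: "z = (x, y)" and z': "z' = (x', y')"
    by (metis surj_pair)
  have "L > 0" using smooth by (simp add: L_smooth_def)
  define g g' gs where "g = gradient F x" and "g' = gradient F x'" and "gs = gradient F xs"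
  note g_defs = g_def[symmetric] g'_def[symmetric] gs_def[symmetric]
  define v v' where "v = y - xs" and "v' = y' - xs"
  have "(x' - x) /\<^sub>R \<alpha> = 2 *\<^sub>R y' - y - x'" and
    "(y' - y) /\<^sub>R \<alpha> = - ((1 / \<mu>) *\<^sub>R (g + N y'))"
    using step by (auto simp: z z' aor_vos_step_def g_def)
  \<comment> \<open>Clear the denominators and center everything at the equilibrium.\<close>
  then have "\<alpha> *\<^sub>R ((x' - x) /\<^sub>R \<alpha>) = \<alpha> *\<^sub>R (2 *\<^sub>R y' - y - x')" and
    "(\<mu> * \<alpha>) *\<^sub>R ((y' - y) /\<^sub>R \<alpha>) = (\<mu> * \<alpha>) *\<^sub>R (- ((1 / \<mu>) *\<^sub>R (g + N y')))"
    by simp_all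
  moreover have cancel: "\<alpha> * (\<mu> * inverse \<alpha>) = \<mu>"
    using \<open>\<alpha> > 0\<close> by simp
  ultimately have x_step: "x' - x = \<alpha> *\<^sub>R (2 *\<^sub>R v' - v - (x' - xs))" and
    y_step: "\<mu> *\<^sub>R (v' - v) = - (\<alpha> *\<^sub>R ((g - gs) + (N y' - N xs)))"
    using \<open>\<alpha> > 0\<close> \<open>\<mu> > 0\<close> equil cancel
    by (simp_all add: v_def v'_def gs_def eq_neg_iff_add_eq_0 algebra_simps scaleR_2)
  have x_part: "bregman F x' xs - bregman F x xs
      = \<alpha> * ((g' - gs) \<bullet> (2 *\<^sub>R v' - v - (x' - xs))) - bregman F x x'"
  proof -
    have "bregman F x' xs - bregman F x xs = (g' - gs) \<bullet> (x' - x) - bregman F x x'"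
      by (simp add: bregman_def g_defs inner_diff_left inner_diff_right)
    also have "(g' - gs) \<bullet> (x' - x) = \<alpha> * ((g' - gs) \<bullet> (2 *\<^sub>R v' - v - (x' - xs)))"
      by (subst x_step) simp
    finally show ?thesis .
  qed
  have y_part: "\<mu> / 2 * (norm v')\<^sup>2 - \<mu> / 2 * (norm v)\<^sup>2
      \<le> - (\<alpha> * ((g - gs) \<bullet> v')) - \<alpha> * \<mu> * (norm v')\<^sup>2 - \<mu> / 2 * (norm (v' - v))\<^sup>2"
  proof -
    have "\<mu> / 2 * (norm v')\<^sup>2 - \<mu> / 2 * (norm v)\<^sup>2
        = (\<mu> *\<^sub>R (v' - v)) \<bullet> v' - \<mu> / 2 * (norm (v' - v))\<^sup>2"
      by (simp add: power2_norm_eq_inner inner_diff_left inner_diff_right inner_commute field_simps)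
    also have "(\<mu> *\<^sub>R (v' - v)) \<bullet> v' = - (\<alpha> * ((g - gs) \<bullet> v')) - \<alpha> * ((N y' - N xs) \<bullet> v')"
      unfolding y_step by (simp add: inner_add_left inner_diff_left algebra_simps)
    finally show ?thesis
      using mult_left_mono[of "\<mu> * (norm v')\<^sup>2" "(N y' - N xs) \<bullet> v'" \<alpha>] mono \<open>\<alpha> > 0\<close>
      by (simp add: strongly_monotone_def v'_def)
  qed
  have "shifted_energy \<alpha> \<mu> F xs z' + \<alpha> * dissipation \<mu> F xs z' - shifted_energy \<alpha> \<mu> F xs z
      \<le> \<alpha> * ((g' - g) \<bullet> (v' - v)) - bregman F x x' - \<mu> / 2 * (norm (v' - v))\<^sup>2"
    using x_part y_part
    unfolding z z' shifted_energy_def energy_def dissipation_def prod.case g_defs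
      v_def[symmetric] v'_def[symmetric]
    by (simp add: inner_diff_left inner_diff_right algebra_simps)
  also have "\<dots> \<le> 0"
    using weighted_young[OF \<open>L > 0\<close> step_size, of "g' - g" "v' - v"]
      gradient_gap_le_bregman[OF conv smooth, of x x']
    by (simp add: g_defs norm_minus_commute)
  finally show ?thesis by simp
qed

section \<open>Linear convergence\<close>

theorem theorem6p1:
  fixes F :: "'a::{real_inner, complete_space} \<Rightarrow> real"
    and N :: "'a \<Rightarrow> 'a"
    and x y :: "nat \<Rightarrow> 'a"
    and xs :: 'a
    and L \<mu> \<alpha> :: real
  assumes "convex_on UNIV F"
    and "L_smooth L F"
    and "\<mu> > 0"
    and "strongly_monotone \<mu> N"
    and "gradient F xs + N xs = 0"
    and "\<alpha> = sqrt (\<mu> / L)"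
    and "\<forall>k. aor_vos_step \<alpha> \<mu> F N (x k, y k) (x (Suc k), y (Suc k))"
  shows "lyapunov_function (aor_vos_step \<alpha> \<mu> F N) (xs, xs) (shifted_energy \<alpha> \<mu> F xs) \<and>
    (\<forall>k. shifted_energy \<alpha> \<mu> F xs (x (Suc k), y (Suc k))
           \<le> (1 / (1 + sqrt (\<mu> / L))) ^ (k + 1) * shifted_energy \<alpha> \<mu> F xs (x 0, y 0)) \<and>
    (\<forall>k. energy \<mu> F xs (x (Suc k), y (Suc k))
           \<le> sqrt (L / \<mu>) * (1 / (1 + sqrt (\<mu> / L))) ^ k * shifted_energy \<alpha> \<mu> F xs (x 0, y 0))"
proof -
  note conv = assms(1) and smooth = assms(2) and pos = assms(3) and mono = assms(4)
    and equil = assms(5)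
  let ?step = "aor_vos_step \<alpha> \<mu> F N" and ?E = "energy \<mu> F xs"
    and ?S = "shifted_energy \<alpha> \<mu> F xs" and ?D = "dissipation \<mu> F xs"
  have "L > 0" using smooth by (simp add: L_smooth_def)
  then have \<alpha>: "\<alpha> > 0" and step_size: "\<alpha>\<^sup>2 * L = \<mu>"
    using pos by (simp_all add: assms(6))
  have nonneg: "0 \<le> ?S z" for z
    by (rule shifted_energy_nonneg[OF conv smooth step_size])
  have decrease: "?S z' + \<alpha> * ?D z' \<le> ?S z" if "?step z z'" for z z'
    by (rule shifted_energy_decrease[OF conv smooth mono equil pos \<alpha> step_size that])
  have contract: "?S z' \<le> 1 / (1 + \<alpha>) * ?S z" if "?step z z'" for z z'
  proof -
    have "\<alpha> * ?S z' \<le> \<alpha> * ?D z'"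
      using \<alpha> shifted_energy_le_dissipation[OF conv smooth step_size] by simp
    then have "(1 + \<alpha>) * ?S z' \<le> ?S z"
      using decrease[OF that] by (simp add: algebra_simps)
    then show ?thesis using \<alpha> by (simp add: field_simps)
  qed
  have energy_bound: "?E z' \<le> 1 / \<alpha> * ?S z" if "?step z z'" for z z'
  proof -
    have "\<alpha> * ?E z' \<le> \<alpha> * ?D z'"
      using \<alpha> energy_le_dissipation[OF conv smooth] pos by simp
    then have "\<alpha> * ?E z' \<le> ?S z"
      using decrease[OF that] nonneg[of z'] by linarith
    then show ?thesis using \<alpha> by (simp add: field_simps)
  qed
  have geometric: "?S (x k, y k) \<le> (1 / (1 + \<alpha>)) ^ k * ?S (x 0, y 0)" for k
  proof (induction k)
    case (Suc k)
    have "?S (x (Suc k), y (Suc k)) \<le> 1 / (1 + \<alpha>) * ?S (x k, y k)"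
      using assms(7) contract by blast
    also have "\<dots> \<le> 1 / (1 + \<alpha>) * ((1 / (1 + \<alpha>)) ^ k * ?S (x 0, y 0))"
      using Suc \<alpha> by (intro mult_left_mono) auto
    finally show ?case by simp
  qed simp
  have "?step (xs, xs) (xs, xs)"
    using equil by (simp add: aor_vos_step_def scaleR_2)
  moreover have "?S (xs, xs) = 0"
    by (simp add: shifted_energy_def energy_def bregman_def)
  moreover have "?S z' \<le> ?S z" if "?step z z'" for z z'
  proof -
    have "0 \<le> \<alpha> * ?S z'" using \<alpha> nonneg by simp
    also have "\<dots> \<le> \<alpha> * ?D z'"
      using \<alpha> shifted_energy_le_dissipation[OF conv smooth step_size] by simp
    finally show ?thesis using decrease[OF that] by linarith
  qed
  ultimately have "lyapunov_function ?step (xs, xs) ?S"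
    using nonneg by (simp add: lyapunov_function_def)
  moreover have "?S (x (Suc k), y (Suc k)) \<le> (1 / (1 + sqrt (\<mu> / L))) ^ (k + 1) * ?S (x 0, y 0)"
    for k
    using geometric[of "Suc k"] unfolding assms(6) by simp
  moreover have "?E (x (Suc k), y (Suc k))
      \<le> sqrt (L / \<mu>) * (1 / (1 + sqrt (\<mu> / L))) ^ k * ?S (x 0, y 0)" for k
  proof -
    have "?E (x (Suc k), y (Suc k)) \<le> 1 / \<alpha> * ?S (x k, y k)"
      using assms(7) energy_bound by blast
    also have "\<dots> \<le> 1 / \<alpha> * ((1 / (1 + \<alpha>)) ^ k * ?S (x 0, y 0))"
      using geometric \<alpha> by (intro mult_left_mono) auto
    also have "1 / \<alpha> = sqrt (L / \<mu>)"
      by (simp add: assms(6) real_sqrt_divide)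
    finally show ?thesis
      by (simp add: assms(6) mult.assoc)
  qed
  ultimately show ?thesis by blast
qed

end
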